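(* There is a computable Turing functional $\Phi$ such that for every $\epsilon$ with $0<\epsilon<2$ there is some $N_\epsilon$ such that $\Phi(\epsilon)$ is an infinite $\{0,1\}$-valued sequence in which any two identical intervals of length $n>N_\epsilon$ have distance greater than $f(n)=(2-\epsilon)^n$. That is, writing $\Phi(\epsilon)=a_1,a_2,a_3,\dots$, if $k<\ell$, $n>N_\epsilon$ and $a_{k+s}=a_{\ell+s}$ for all $0\le s<n$, then $\ell-k>(2-\epsilon)^n$.
   Context: $\Phi(\epsilon)$ denotes the output of $\Phi$ when given (a standard name of) the real number $\epsilon$ as oracle input. The distance of two intervals $a_k,\dots,a_{k+n-1}$ and $a_\ell,\dots,a_{\ell+n-1}$ with $k<\ell$ is $\ell-k$. *)

theory Defs
  imports Complex_Main "HOL-Library.Nat_Bijection"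
begin

text \<open>
  Turing functionals are given by Kleene's schemata for partial recursive functions, extended by
  one basic function that queries an oracle \<open>g :: nat \<Rightarrow> nat\<close>. The program is a finite object that
  does not depend on the oracle.
\<close>

datatype program =
    Zero
  | Succ
  | Proj nat
  | Oracle
  | Comp program "program list"
  | PrimRec program program
  | Mu program

text \<open>
  \<open>computes g p xs y\<close>: with oracle \<open>g\<close>, program \<open>p\<close> halts on input \<open>xs\<close> with output \<open>y\<close>.
  Divergence, as well as a wrong number of arguments, is the absence of such a \<open>y\<close>. Recursion is
  on the first argument, and \<open>Mu p\<close> searches for the least value of the first argument of \<open>p\<close> at
  which \<open>p\<close> returns 0, all earlier values being required to halt.
\<close>

inductive computes :: "(nat \<Rightarrow> nat) \<Rightarrow> program \<Rightarrow> nat list \<Rightarrow> nat \<Rightarrow> bool"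
  for g :: "nat \<Rightarrow> nat" where
  zero: "computes g Zero xs 0"
| succ: "computes g Succ [x] (Suc x)"
| proj: "i < length xs \<Longrightarrow> computes g (Proj i) xs (xs ! i)"
| query: "computes g Oracle [x] (g x)"
| comp: "list_all2 (\<lambda>q y. computes g q xs y) qs ys \<Longrightarrow> computes g p ys z \<Longrightarrow>
    computes g (Comp p qs) xs z"
| primrec_0: "computes g p xs y \<Longrightarrow> computes g (PrimRec p q) (0 # xs) y"
| primrec_Suc: "computes g (PrimRec p q) (n # xs) y \<Longrightarrow> computes g q (n # y # xs) z \<Longrightarrow>
    computes g (PrimRec p q) (Suc n # xs) z"
| mu: "computes g p (m # xs) 0 \<Longrightarrow> (\<And>i. i < m \<Longrightarrow> \<exists>y > 0. computes g p (i # xs) y) \<Longrightarrow>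
    computes g (Mu p) xs m"

lemma computes_deterministic:
  "computes g p xs y \<Longrightarrow> computes g p xs z \<Longrightarrow> y = z"
proof (induction arbitrary: z rule: computes.induct)
  case (zero xs)
  then show ?case by cases auto
next
  case (succ x)
  then show ?case by cases auto
next
  case (proj i xs)
  from proj.prems show ?case by cases auto
next
  case (query x)
  then show ?case by cases auto
next
  case (comp xs qs ys p w)
  from comp.prems obtain ys' where ys':
    "list_all2 (\<lambda>q y. computes g q xs y) qs ys'" "computes g p ys' z"
    by cases
  have "ys = ys'"
    using comp.IH(1) ys'(1) by (auto simp: list_all2_conv_all_nth intro!: nth_equalityI)
  then show ?case using comp.IH(2) ys'(2) by blast
next
  case (primrec_0 p xs y q)
  from primrec_0.prems show ?case by cases (auto dest: primrec_0.IH)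
next
  case (primrec_Suc p q n xs y w)
  from primrec_Suc.prems obtain y' where
    "computes g (PrimRec p q) (n # xs) y'" "computes g q (n # y' # xs) z"
    by cases auto
  then show ?case using primrec_Suc.IH by blast
next
  case (mu p m xs)
  from mu.prems have z: "computes g p (z # xs) 0"
    "\<And>i. i < z \<Longrightarrow> \<exists>y > 0. computes g p (i # xs) y"
    by (cases, auto)+
  show ?case
  proof (rule linorder_cases[of m z])
    assume "m < z"
    then show ?thesis using z(2) mu.IH(1) by (metis less_irrefl)
  next
    assume "z < m"
    then show ?thesis using z(1) mu.IH(2) by (metis less_irrefl)
  qed
qed

lemma computable_functional_ex:
  obtains \<Phi> where "\<And>g i y. \<Phi> g i = Some y \<longleftrightarrow> computes g p [i] y"
proof
  fix g i y
  show "(\<lambda>g i. if \<exists>y. computes g p [i] y then Some (THE y. computes g p [i] y) else None) g i = Some y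
    \<longleftrightarrow> computes g p [i] y"
    by (auto intro: theI the_equality dest: computes_deterministic)
qed

text \<open>
  \<open>\<Phi> g i = Some y\<close> means that the functional, run with oracle \<open>g\<close> on input \<open>i\<close>, outputs \<open>y\<close>, and
  \<open>\<Phi> g i = None\<close> that it diverges.
\<close>

definition computable_functional :: "((nat \<Rightarrow> nat) \<Rightarrow> nat \<Rightarrow> nat option) \<Rightarrow> bool" where
  "computable_functional \<Phi> \<longleftrightarrow> (\<exists>p. \<forall>g i y. \<Phi> g i = Some y \<longleftrightarrow> computes g p [i] y)"

definition rat_decode :: "nat \<Rightarrow> rat" where
  "rat_decode c = (case prod_decode c of (a, b) \<Rightarrow> of_int (int_decode a) / of_nat (Suc b))"

text \<open>
  The standard (Cauchy) names of a real number are the sequences of codes of rational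
  approximations with error at most \<open>2\<^sup>-\<^sup>n\<close>. A real has many names.
\<close>

definition real_name :: "(nat \<Rightarrow> nat) \<Rightarrow> real \<Rightarrow> bool" where
  "real_name g x \<longleftrightarrow> (\<forall>n. \<bar>of_rat (rat_decode (g n)) - x\<bar> \<le> 1 / 2 ^ n)"

end

theory Submission
  imports Defs
begin

text \<open>
  If \<open>\<epsilon> \<ge> 1/j\<close>, it suffices to avoid, for each \<open>k < l\<close>, a match of the blocks at \<open>k\<close> and \<open>l\<close> of one
  length \<open>m (l - k)\<close>, the least \<open>n > N\<close> with \<open>l - k \<le> (2 - 1/j) ^ n\<close>. Fix \<open>1/2 < c < 1/(2 - 1/j)\<close> and
  give each pair whose blocks agree so far the weight \<open>c\<close> to the number of digits it still lacks.
  At each step a surviving pair survives for exactly one choice of the next digit, so the total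
  weights after appending 0 and 1 add up to at most \<open>1/c\<close> times the old weight plus that of the new
  pairs, which is at most \<open>\<Sum>d. c ^ m d \<le> 2 c - 1\<close> when \<open>N\<close> is large. Choosing the digit of smaller
  weight therefore keeps the weight below 1, whereas a completed match has weight 1. With rational
  \<open>c\<close> this choice is primitive recursive in \<open>j\<close>, and \<open>j\<close> is found by searching the oracle.
\<close>

subsection \<open>The weight argument\<close>

text \<open>Weight of the pairs of blocks starting at \<open>k < l\<close> that agree so far and may still complete a
  match of length \<open>m (l - k)\<close>: a pair costs \<open>c\<close> to the number of missing digits. The blocks may
  overlap, as digit \<open>l + s\<close> is only compared with the earlier digit \<open>k + s\<close>.\<close>

definition potential :: "real \<Rightarrow> (nat \<Rightarrow> nat) \<Rightarrow> (nat \<Rightarrow> bool) \<Rightarrow> nat \<Rightarrow> real" where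
  "potential c m u t = (\<Sum>l<t. \<Sum>k<l.
     if t \<le> l + m (l - k) \<and> (\<forall>s<t - l. u (k + s) = u (l + s)) then c ^ (l + m (l - k) - t) else 0)"

text \<open>Only digits below \<open>t\<close> are read, as \<open>k + s < l + s < t\<close>; so a
  finite word can stand in for the infinite sequence.\<close>

lemma potential_cong:
  assumes "\<And>i. i < t \<Longrightarrow> u i = v i"
  shows "potential c m u t = potential c m v t"
proof -
  have "(\<forall>s<t - l. u (k + s) = u (l + s)) \<longleftrightarrow> (\<forall>s<t - l. v (k + s) = v (l + s))"
    if "l < t" "k < l" for k l
    using that assms by (metis add.commute less_diff_conv add_strict_right_mono less_trans)
  then show ?thesis
    unfolding potential_def by (intro sum.cong refl if_cong) auto
qed

text \<open>A surviving old pair forces digit \<open>t\<close> to equal digit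
  \<open>k + (t - l)\<close>, a new pair forces it to equal digit \<open>k\<close>; so at most one
  branch keeps the pair, with one digit fewer missing. Completed pairs drop out, hence only an
  inequality.\<close>

lemma potential_branch:
  assumes c: "0 < c"
  shows "potential c m (u(t := False)) (Suc t) + potential c m (u(t := True)) (Suc t)
    \<le> (potential c m u t + (\<Sum>k<t. c ^ m (t - k))) / c"
proof -
  define T where "T = (\<lambda>v t l k. if t \<le> l + m (l - k) \<and> (\<forall>s<t - l. v (k + s) = (v (l + s) :: bool))
    then c ^ (l + m (l - k) - t) else 0)"
  have pot: "potential c m v t = (\<Sum>l<t. \<Sum>k<l. T v t l k)" for v t
    by (simp add: potential_def T_def)
  have shift: "c ^ (n - Suc t) = c ^ (n - t) / c" if "Suc t \<le> n" for n
  proof -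
    have "n - t = Suc (n - Suc t)" using that by simp
    then show ?thesis using c by simp
  qed
  have old: "T (u(t := False)) (Suc t) l k + T (u(t := True)) (Suc t) l k \<le> T u t l k / c"
    if "k < l" "l < t" for k l
  proof -
    have *: "(\<forall>s<Suc t - l. (u(t := b)) (k + s) = (u(t := b)) (l + s)) \<longleftrightarrow>
      (\<forall>s<t - l. u (k + s) = u (l + s)) \<and> u (k + (t - l)) = b" for b
    proof -
      have suc: "Suc t - l = Suc (t - l)" using that by simp
      have "k + (t - l) \<noteq> t" "l + (t - l) = t" using that by linarith+
      moreover have "k + s \<noteq> t" "l + s \<noteq> t" if "s < t - l" for s
        using that \<open>k < l\<close> by linarith+
      ultimately show ?thesis
        unfolding suc All_less_Suc by (metis fun_upd_other fun_upd_same)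
    qed
    show ?thesis
      unfolding T_def * using c shift[of "l + m (l - k)"]
      by (cases "u (k + (t - l))") auto
  qed
  have new: "T (u(t := False)) (Suc t) t k + T (u(t := True)) (Suc t) t k \<le> c ^ m (t - k) / c"
    if "k < t" for k
    using that c shift[of "t + m (t - k)"] by (auto simp: T_def)
  have "potential c m (u(t := False)) (Suc t) + potential c m (u(t := True)) (Suc t) =
    (\<Sum>l<t. \<Sum>k<l. T (u(t := False)) (Suc t) l k + T (u(t := True)) (Suc t) l k) +
    (\<Sum>k<t. T (u(t := False)) (Suc t) t k + T (u(t := True)) (Suc t) t k)"
    by (simp add: pot sum.distrib)
  also have "\<dots> \<le> (\<Sum>l<t. \<Sum>k<l. T u t l k / c) + (\<Sum>k<t. c ^ m (t - k) / c)"
    using old new by (intro add_mono sum_mono) auto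
  also have "\<dots> = (potential c m u t + (\<Sum>k<t. c ^ m (t - k))) / c"
    by (simp add: pot add_divide_distrib sum_divide_distrib)
  finally show ?thesis .
qed

text \<open>At time \<open>l + m (l - k)\<close> no digit is missing, so this pair alone contributes
  \<open>c ^ 0 = 1\<close>; the other terms are nonnegative.\<close>

lemma potential_match:
  assumes "0 < c" "k < l" "0 < m (l - k)" "\<And>s. s < m (l - k) \<Longrightarrow> u (k + s) = u (l + s)"
  shows "1 \<le> potential c m u (l + m (l - k))"
proof -
  define T where "T = (\<lambda>l' k'. if l + m (l - k) \<le> l' + m (l' - k') \<and>
    (\<forall>s<l + m (l - k) - l'. u (k' + s) = u (l' + s))
    then c ^ (l' + m (l' - k') - (l + m (l - k))) else 0)"
  have nonneg: "0 \<le> T l' k'" for l' k' using assms(1) by (simp add: T_def)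
  have "1 = T l k" using assms by (simp add: T_def)
  also have "\<dots> \<le> (\<Sum>k'<l. T l k')"
    using assms(2) nonneg by (intro member_le_sum) auto
  also have "\<dots> \<le> (\<Sum>l'<l + m (l - k). \<Sum>k'<l'. T l' k')"
    using assms(3) nonneg by (intro member_le_sum[where f = "\<lambda>l'. \<Sum>k'<l'. T l' k'"]) (auto intro: sum_nonneg)
  finally show ?thesis by (simp add: potential_def T_def)
qed

text \<open>The invariant is a potential below 1: the lighter branch has at most half of the total,
  which is below \<open>(1 + (2 * c - 1)) / c = 2\<close>.\<close>

lemma greedy_avoids_matches:
  assumes c: "0 < c"
    and sum: "\<And>t. (\<Sum>k<t. c ^ m (t - k)) \<le> 2 * c - 1"
    and m: "\<And>d. 0 < m d"
    and greedy: "\<And>t. u t \<longleftrightarrow>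
      potential c m (u(t := True)) (Suc t) < potential c m (u(t := False)) (Suc t)"
    and "k < l"
  shows "\<exists>s < m (l - k). u (k + s) \<noteq> u (l + s)"
proof -
  have "potential c m u t < 1" for t
  proof (induction t)
    case 0
    then show ?case by (simp add: potential_def)
  next
    case (Suc t)
    have eq: "u(t := u t) = u" by simp
    have "potential c m u (Suc t) \<le> potential c m (u(t := b)) (Suc t)" for b
      using greedy[of t] eq by (cases b; cases "u t") (metis less_imp_le not_le order_refl)+
    from this[of False] this[of True]
    have "2 * potential c m u (Suc t) \<le>
        potential c m (u(t := False)) (Suc t) + potential c m (u(t := True)) (Suc t)" by simp
    also have "\<dots> \<le> (potential c m u t + (\<Sum>k<t. c ^ m (t - k))) / c"
      by (rule potential_branch[OF c])
    also have "\<dots> < (1 + (2 * c - 1)) / c"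
      using Suc sum[of t] c by (intro divide_strict_right_mono) auto
    finally show ?case using c by simp
  qed
  then show ?thesis
    using potential_match[of c k l m u] c m \<open>k < l\<close> by (meson not_le)
qed

subsection \<open>Thresholds\<close>

text \<open>Lets a bounded sum replace a bounded search, in \<open>threshold\<close>,
  \<open>div_program\<close> and \<open>diagonal_program\<close>.\<close>

lemma sum_of_bool_initial:
  assumes "\<And>i. i < n \<Longrightarrow> P i \<longleftrightarrow> i < (c::nat)" "c \<le> n"
  shows "(\<Sum>i<n. of_bool (P i)) = c"
proof -
  have "(\<Sum>i<n. of_bool (P i)) = (\<Sum>i<c. 1 :: nat)"
    using assms by (intro sum.mono_neutral_cong_right) auto
  then show ?thesis by simp
qed

text \<open>With \<open>L = 4 * j - 1\<close>, Bernoulli gives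
  \<open>(1 + 1 / L) ^ (L ^ 3) \<ge> L ^ 2\<close>, which makes the geometric tail in
  \<open>threshold_sum\<close> small enough.\<close>

definition cutoff :: "nat \<Rightarrow> nat" where
  "cutoff j = (4 * j - 1) ^ 3"

text \<open>The least \<open>n > cutoff j\<close> with \<open>d \<le> (2 - 1/j) ^ n\<close>, see \<open>threshold_eq_Least\<close>; a bounded sum is
  a primitive recursive definition.\<close>

definition threshold :: "nat \<Rightarrow> nat \<Rightarrow> nat" where
  "threshold j d = (\<Sum>n<cutoff j + 1 + 2 * d.
     of_bool (\<not> (cutoff j < n \<and> d * j ^ n \<le> (2 * j - 1) ^ n)))"

text \<open>Since \<open>j \<le> 2 * j - 1\<close>, the condition is closed upwards in
  \<open>n\<close>, so its failures form an initial segment and can be counted.\<close>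

lemma threshold_cond_mono:
  assumes "1 \<le> j" "n \<le> n'" "cutoff j < n" "d * j ^ n \<le> (2 * j - 1) ^ n"
  shows "cutoff j < n' \<and> d * j ^ n' \<le> (2 * j - 1) ^ n'"
proof
  show "cutoff j < n'" using assms by simp
  have "d * j ^ n' = (d * j ^ n) * j ^ (n' - n)"
    using assms(2) by (simp add: mult.assoc flip: power_add)
  also have "\<dots> \<le> (2 * j - 1) ^ n * (2 * j - 1) ^ (n' - n)"
    using assms by (intro mult_mono power_mono) auto
  also have "\<dots> = (2 * j - 1) ^ n'"
    using assms(2) by (simp flip: power_add)
  finally show "d * j ^ n' \<le> (2 * j - 1) ^ n'" .
qed

lemma threshold_cond_ex:
  assumes "2 \<le> j"
  shows "d * j ^ (cutoff j + 1 + 2 * d) \<le> (2 * j - 1) ^ (cutoff j + 1 + 2 * d)"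
proof -
  define n where "n = cutoff j + 1 + 2 * d"
  have "real d \<le> 1 + real n * (1/2)" by (simp add: n_def field_simps)
  also have "\<dots> \<le> (1 + 1/2) ^ n" by (rule Bernoulli_inequality) simp
  also have "\<dots> \<le> ((2 * real j - 1) / real j) ^ n"
    using assms by (intro power_mono) (auto simp: field_simps)
  finally have "real (d * j ^ n) \<le> real ((2 * j - 1) ^ n)"
    using assms by (simp add: power_divide field_simps of_nat_diff)
  then show ?thesis unfolding n_def by (simp only: of_nat_le_iff)
qed

lemma threshold_eq_Least:
  assumes "2 \<le> j"
  shows "threshold j d = (LEAST n. cutoff j < n \<and> d * j ^ n \<le> (2 * j - 1) ^ n)"
proof -
  let ?P = "\<lambda>n. cutoff j < n \<and> d * j ^ n \<le> (2 * j - 1) ^ n"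
  let ?n = "cutoff j + 1 + 2 * d"
  have P: "?P ?n" using threshold_cond_ex[OF assms] by simp
  show ?thesis
    unfolding threshold_def
  proof (rule sum_of_bool_initial)
    show "Least ?P \<le> ?n" using P by (rule Least_le)
    have "?P i" if "Least ?P \<le> i" for i
      using threshold_cond_mono[where j = j and d = d, OF _ that] LeastI[of ?P, OF P] assms by simp
    moreover have "\<not> ?P i" if "i < Least ?P" for i
      using that by (rule not_less_Least)
    ultimately show "\<not> ?P i \<longleftrightarrow> i < Least ?P" for i
      by (meson not_le)
  qed
qed

lemma threshold_props:
  assumes "2 \<le> j"
  shows "cutoff j < threshold j d"
    and "d * j ^ threshold j d \<le> (2 * j - 1) ^ threshold j d"
    and "threshold j d \<le> cutoff j + 1 + 2 * d"
    and "cutoff j < n \<Longrightarrow> d * j ^ n \<le> (2 * j - 1) ^ n \<Longrightarrow> threshold j d \<le> n"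
proof -
  let ?P = "\<lambda>n. cutoff j < n \<and> d * j ^ n \<le> (2 * j - 1) ^ n"
  have P: "?P (cutoff j + 1 + 2 * d)" using threshold_cond_ex[OF assms] by simp
  show "cutoff j < threshold j d" "d * j ^ threshold j d \<le> (2 * j - 1) ^ threshold j d"
    using LeastI[of ?P, OF P] by (auto simp: threshold_eq_Least[OF assms])
  show "threshold j d \<le> cutoff j + 1 + 2 * d"
    using P unfolding threshold_eq_Least[OF assms] by (rule Least_le)
  show "threshold j d \<le> n" if "cutoff j < n" "d * j ^ n \<le> (2 * j - 1) ^ n"
    using that unfolding threshold_eq_Least[OF assms] by (intro Least_le) simp
qed

text \<open>Here \<open>1 / c = 2 - 1 / (2 * j)\<close> is midway between
  \<open>b = 2 - 1 / j\<close> and 2. At most \<open>b ^ n\<close> distances have threshold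
  \<open>n\<close>, and they contribute at most \<open>(b * c) ^ n = q ^ n\<close>; a geometric tail
  beyond the cutoff remains.\<close>

lemma threshold_sum:
  fixes c :: real
  assumes j: "2 \<le> j" and c_def: "c = 2 * real j / (4 * real j - 1)"
  shows "(\<Sum>k<t. c ^ threshold j (t - k)) \<le> 2 * c - 1"
proof -
  define L where "L = 4 * real j - 1"
  define q where "q = 1 - 1 / L"
  define b where "b = (2 * real j - 1) / real j"
  define N where "N = cutoff j"
  have L: "7 \<le> L" using j by (simp add: L_def)
  have q: "0 < q" "q < 1" using L by (auto simp: q_def)
  have bc: "b * c = q" using j by (simp add: b_def c_def q_def L_def field_simps)
  have c: "0 < c" using j by (simp add: c_def)
  have count: "(\<Sum>k\<in>{k\<in>{..<t}. threshold j (t - k) = n}. c ^ threshold j (t - k)) \<le> q ^ n" for n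
  proof -
    define A where "A = {k\<in>{..<t}. threshold j (t - k) = n}"
    have le: "real (t - k) \<le> b ^ n" if "k \<in> A" for k
    proof -
      have n: "threshold j (t - k) = n" using that by (simp add: A_def)
      have "real ((t - k) * j ^ n) \<le> real ((2 * j - 1) ^ n)"
        using threshold_props(2)[OF j, of "t - k"] unfolding n of_nat_le_iff .
      then have "real (t - k) * real j ^ n \<le> (2 * real j - 1) ^ n"
        using j by (simp only: of_nat_mult of_nat_power of_nat_diff) simp
      then show ?thesis
        using j by (simp add: b_def power_divide pos_le_divide_eq)
    qed
    have "inj_on (\<lambda>k. t - k) A"
      by (rule inj_on_subset[of _ "{..t}"]) (auto simp: A_def inj_on_def)
    moreover have "(\<lambda>k. t - k) ` A \<subseteq> {1..nat \<lfloor>b ^ n\<rfloor>}"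
      using le by (auto simp: A_def intro!: le_nat_floor)
    ultimately have "card A \<le> nat \<lfloor>b ^ n\<rfloor>"
      using card_inj_on_le[of "\<lambda>k. t - k" A "{1..nat \<lfloor>b ^ n\<rfloor>}"] by simp
    moreover have "real (nat \<lfloor>b ^ n\<rfloor>) \<le> b ^ n"
      using j by (intro of_nat_floor) (simp add: b_def)
    ultimately have "real (card A) \<le> b ^ n" by linarith
    then have "real (card A) * c ^ n \<le> b ^ n * c ^ n"
      using c by (intro mult_right_mono) auto
    moreover have "b ^ n * c ^ n = q ^ n" unfolding bc[symmetric] by (rule power_mult_distrib[symmetric])
    moreover have "(\<Sum>k\<in>A. c ^ threshold j (t - k)) = real (card A) * c ^ n" by (simp add: A_def)
    ultimately show ?thesis unfolding A_def by simp
  qed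
  define I where "I = (\<lambda>k. threshold j (t - k)) ` {..<t}"
  have I: "finite I" "I \<subseteq> {Suc N..}"
    using threshold_props(1)[OF j] by (auto simp: I_def N_def Suc_le_eq)
  have "(\<Sum>k<t. c ^ threshold j (t - k)) =
      (\<Sum>n\<in>I. \<Sum>k\<in>{k\<in>{..<t}. threshold j (t - k) = n}. c ^ threshold j (t - k))"
    by (rule sum.group[symmetric]) (auto simp: I_def)
  also have "\<dots> \<le> (\<Sum>n\<in>I. q ^ n)" by (intro sum_mono count)
  \<comment> \<open>For \<open>t = 0\<close> the set \<open>I\<close> is empty and
    \<open>Max I\<close> unspecified; the outer \<open>max\<close> keeps the interval nonempty for
    \<open>sum_gp\<close>.\<close>
  also have "\<dots> \<le> (\<Sum>n=Suc N..max (Suc N) (Max I). q ^ n)"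
  proof (rule sum_mono2)
    show "I \<subseteq> {Suc N..max (Suc N) (Max I)}"
      using I by (auto intro!: max.coboundedI2)
  qed (use q in auto)
  also have "\<dots> \<le> q ^ Suc N / (1 - q)"
    using q by (simp add: sum_gp divide_right_mono)
  also have "\<dots> \<le> 2 * c - 1"
  proof -
    \<comment> \<open>Since \<open>(1 + 1 / L) * q \<le> 1\<close>, a lower bound on
      \<open>(1 + 1 / L) ^ N\<close> yields an upper bound on \<open>q ^ N\<close>.\<close>
    have "(1 + 1 / L) ^ N * q ^ N = ((1 + 1 / L) * q) ^ N" by (simp add: power_mult_distrib)
    also have "\<dots> \<le> 1"
    proof (rule power_le_one)
      have "(1 + 1 / L) * q = 1 - (1 / L)\<^sup>2" by (simp add: q_def algebra_simps power2_eq_square)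
      then show "(1 + 1 / L) * q \<le> 1" by simp
    qed (use q L in simp)
    finally have "(1 + 1 / L) ^ N * q ^ N \<le> 1" .
    moreover have "L ^ 2 \<le> (1 + 1 / L) ^ N"
    proof -
      have "real N = L ^ 3" using j by (simp add: N_def cutoff_def L_def of_nat_diff)
      then have "L ^ 2 \<le> 1 + real N * (1 / L)" using L by (simp add: power2_eq_square power3_eq_cube)
      also have "\<dots> \<le> (1 + 1 / L) ^ N" using L by (intro Bernoulli_inequality) (simp add: field_simps)
      finally show ?thesis .
    qed
    ultimately have "L ^ 2 * q ^ N \<le> 1"
      using q by (meson mult_right_mono order.trans zero_le_power less_imp_le)
    then have "(L ^ 2 * q ^ N) * q \<le> 1 * 1"
      using q by (intro mult_mono) auto
    then have "q ^ Suc N * L \<le> 1 / L" using L by (simp add: power2_eq_square field_simps)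
    moreover have "1 - q = 1 / L" "2 * c - 1 = 1 / L"
      using j by (auto simp: q_def c_def L_def field_simps)
    ultimately show ?thesis by simp
  qed
  finally show ?thesis .
qed

subsection \<open>The digit sequence\<close>

text \<open>The potential for \<open>c = 2 j / (4 j - 1)\<close> of the word with binary code \<open>V\<close>, times a power of
  \<open>4 j - 1\<close> that clears all denominators.\<close>

definition scaled_potential :: "nat \<Rightarrow> nat \<Rightarrow> nat \<Rightarrow> nat" where
  "scaled_potential j V t = (\<Sum>l<t. \<Sum>k<l.
     of_bool (t \<le> l + threshold j (l - k)) *
     of_bool (V div 2 ^ k mod 2 ^ (t - l) = V div 2 ^ l) *
     ((2 * j) ^ (l + threshold j (l - k) - t) *
      (4 * j - 1) ^ (cutoff j + 1 + 2 * t - (l + threshold j (l - k) - t))))"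

text \<open>As \<open>V < 2 ^ t\<close>, the quotient \<open>V div 2 ^ l\<close> consists of bits
  \<open>l\<close> to \<open>t - 1\<close>; thus comparing blocks becomes arithmetic on
  codes.\<close>

lemma match_iff_div_mod:
  fixes V :: nat
  assumes "V < 2 ^ t" "l \<le> t"
  shows "V div 2 ^ k mod 2 ^ (t - l) = V div 2 ^ l \<longleftrightarrow>
    (\<forall>s<t - l. bit V (k + s) = bit V (l + s))"
proof -
  have high: "\<not> bit V i" if "t \<le> i" for i
  proof -
    have "V < 2 ^ i" using assms(1) power_increasing[OF that, of "2 :: nat"] by linarith
    then show ?thesis by (simp add: bit_iff_odd)
  qed
  have "V div 2 ^ k mod 2 ^ (t - l) = V div 2 ^ l \<longleftrightarrow>
      take_bit (t - l) (drop_bit k V) = drop_bit l V"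
    by (simp add: take_bit_eq_mod drop_bit_eq_div)
  also have "\<dots> \<longleftrightarrow> (\<forall>s. (s < t - l \<and> bit V (k + s)) = bit V (l + s))"
    by (simp add: bit_eq_iff bit_take_bit_iff bit_drop_bit_eq)
  also have "\<dots> \<longleftrightarrow> (\<forall>s<t - l. bit V (k + s) = bit V (l + s))"
    using high assms(2) by (metis le_diff_conv add.commute not_le)
  finally show ?thesis .
qed

text \<open>The factor depends only on \<open>j\<close> and \<open>t\<close>, not on the word, so
  comparing the integers compares the real potentials.\<close>

lemma scaled_potential:
  assumes j: "2 \<le> j" and V: "V < 2 ^ t"
  shows "real (scaled_potential j V t) = (4 * real j - 1) ^ (cutoff j + 1 + 2 * t) *
    potential (2 * real j / (4 * real j - 1)) (threshold j) (bit V) t"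
proof -
  define B where "B = 4 * real j - 1"
  have B: "B \<noteq> 0" "real (4 * j - 1) = B" using j by (auto simp: B_def of_nat_diff)
  have scale: "(2 * real j) ^ e * B ^ (E - e) = B ^ E * (2 * real j / B) ^ e" if "e \<le> E" for e E
  proof -
    have "B ^ E = B ^ e * B ^ (E - e)" using that by (simp flip: power_add)
    then show ?thesis using B by (simp add: power_divide)
  qed
  have "real (of_bool (t \<le> l + threshold j (l - k)) *
     of_bool (V div 2 ^ k mod 2 ^ (t - l) = V div 2 ^ l) *
     ((2 * j) ^ (l + threshold j (l - k) - t) *
      (4 * j - 1) ^ (cutoff j + 1 + 2 * t - (l + threshold j (l - k) - t)))) =
    B ^ (cutoff j + 1 + 2 * t) *
    (if t \<le> l + threshold j (l - k) \<and> (\<forall>s<t - l. bit V (k + s) = bit V (l + s))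
     then (2 * real j / B) ^ (l + threshold j (l - k) - t) else 0)"
    if "l < t" for k l
  proof -
    \<comment> \<open>The exponent was chosen for this bound: the threshold is at most
      \<open>cutoff j + 1 + 2 * (l - k)\<close> and \<open>l < t\<close>, so the subtraction in the
      exponent of \<open>B\<close> is not truncated.\<close>
    have "l + threshold j (l - k) - t \<le> cutoff j + 1 + 2 * t"
      using threshold_props(3)[OF j, of "l - k"] that by linarith
    then show ?thesis
      using match_iff_div_mod[OF V less_imp_le[OF that], of k] scale B(2) by simp
  qed
  then show ?thesis
    unfolding scaled_potential_def potential_def B_def[symmetric]
    by (simp add: sum_distrib_left del: of_nat_mult)
qed

text \<open>Digit \<open>i\<close> is bit \<open>i\<close> of the code: appending 0 leaves the code
  unchanged, appending 1 adds \<open>2 ^ t\<close>. Ties go to 0.\<close>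

fun prefix_code :: "nat \<Rightarrow> nat \<Rightarrow> nat" where
  "prefix_code j 0 = 0"
| "prefix_code j (Suc t) = prefix_code j t +
     of_bool (scaled_potential j (prefix_code j t + 2 ^ t) (Suc t)
       < scaled_potential j (prefix_code j t) (Suc t)) * 2 ^ t"

definition digit :: "nat \<Rightarrow> nat \<Rightarrow> nat" where
  "digit j t = prefix_code j (Suc t) div 2 ^ t mod 2"

lemma prefix_code_less: "prefix_code j t < 2 ^ t"
  by (induction t) auto

lemma bit_add_power:
  fixes W :: nat
  assumes "W < 2 ^ t"
  shows "bit (W + of_bool b * 2 ^ t) = (bit W)(t := b)"
proof -
  have "\<not> bit W t" using assms by (simp add: bit_iff_odd)
  then have "W + 2 ^ t = set_bit t W" by (simp add: set_bit_eq)
  then show ?thesis using \<open>\<not> bit W t\<close> by (cases b) (auto simp: fun_eq_iff bit_set_bit_iff)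
qed

lemma digit_avoids_matches:
  assumes j: "2 \<le> j" and "k < l"
  shows "\<exists>s < threshold j (l - k). digit j (k + s) \<noteq> digit j (l + s)"
proof -
  define c where "c = 2 * real j / (4 * real j - 1)"
  define u where "u t = bit (prefix_code j (Suc t)) t" for t
  let ?W = "prefix_code j"
  have digit: "digit j t = of_bool (u t)" for t
    by (simp add: digit_def u_def bit_iff_odd mod_2_eq_odd)
  have step: "?W (Suc t) = ?W t + of_bool (u t) * 2 ^ t"
    and u_iff: "u t \<longleftrightarrow> scaled_potential j (?W t + 2 ^ t) (Suc t) < scaled_potential j (?W t) (Suc t)" for t
    by (auto simp: u_def bit_add_power[OF prefix_code_less] simp del: of_bool_eq)
  have bits: "bit (?W t) i = u i" if "i < t" for i t
    using that
  proof (induction t)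
    case (Suc t)
    then show ?case
      unfolding step bit_add_power[OF prefix_code_less] by (cases "i = t") auto
  qed simp
  have pot: "real (scaled_potential j (?W t + of_bool b * 2 ^ t) (Suc t)) =
      (4 * real j - 1) ^ (cutoff j + 1 + 2 * Suc t) * potential c (threshold j) (u(t := b)) (Suc t)" for t b
  proof -
    have "?W t + of_bool b * 2 ^ t < 2 ^ Suc t" using prefix_code_less[of j t] by (cases b) auto
    then have "real (scaled_potential j (?W t + of_bool b * 2 ^ t) (Suc t)) =
      (4 * real j - 1) ^ (cutoff j + 1 + 2 * Suc t) *
      potential c (threshold j) ((bit (?W t))(t := b)) (Suc t)"
      unfolding c_def bit_add_power[OF prefix_code_less, symmetric] by (rule scaled_potential[OF j])
    also have "potential c (threshold j) ((bit (?W t))(t := b)) (Suc t) =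
        potential c (threshold j) (u(t := b)) (Suc t)"
      by (rule potential_cong) (auto simp: bits less_Suc_eq)
    finally show ?thesis .
  qed
  have "\<exists>s < threshold j (l - k). u (k + s) \<noteq> u (l + s)"
  proof (rule greedy_avoids_matches[where c = c])
    show "0 < c" using j by (simp add: c_def)
    show "(\<Sum>k<t. c ^ threshold j (t - k)) \<le> 2 * c - 1" for t
      by (rule threshold_sum[OF j c_def])
    show "0 < threshold j d" for d using threshold_props(1)[OF j, of d] by simp
    show "u t \<longleftrightarrow> potential c (threshold j) (u(t := True)) (Suc t)
        < potential c (threshold j) (u(t := False)) (Suc t)" for t
    proof -
      have "u t \<longleftrightarrow> real (scaled_potential j (?W t + of_bool True * 2 ^ t) (Suc t))
          < real (scaled_potential j (?W t + of_bool False * 2 ^ t) (Suc t))"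
        using u_iff[of t] by simp
      then show ?thesis
        unfolding pot using j by (simp add: mult_less_cancel_left_pos)
    qed
  qed fact
  then show ?thesis by (simp only: digit of_bool_eq_iff)
qed

subsection \<open>Primitive recursive programs\<close>

text \<open>A total evaluator makes program correctness a matter of rewriting. The value at
  \<open>Mu\<close> is a dummy; \<open>arity\<close> excludes it, along with ill-formed
  calls.\<close>

fun ev :: "(nat \<Rightarrow> nat) \<Rightarrow> program \<Rightarrow> nat list \<Rightarrow> nat" where
  "ev g Zero xs = 0"
| "ev g Succ xs = Suc (hd xs)"
| "ev g (Proj i) xs = xs ! i"
| "ev g Oracle xs = g (hd xs)"
| "ev g (Comp p qs) xs = ev g p (map (\<lambda>q. ev g q xs) qs)"
| "ev g (PrimRec p q) xs = rec_nat (ev g p (tl xs)) (\<lambda>n y. ev g q (n # y # tl xs)) (hd xs)"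
| "ev g (Mu p) xs = 0"

fun arity :: "nat \<Rightarrow> program \<Rightarrow> bool" where
  "arity k Zero \<longleftrightarrow> True"
| "arity k Succ \<longleftrightarrow> k = 1"
| "arity k (Proj i) \<longleftrightarrow> i < k"
| "arity k Oracle \<longleftrightarrow> k = 1"
| "arity k (Comp p qs) \<longleftrightarrow> arity (length qs) p \<and> (\<forall>q\<in>set qs. arity k q)"
| "arity k (PrimRec p q) \<longleftrightarrow> 0 < k \<and> arity (k - 1) p \<and> arity (k + 1) q"
| "arity k (Mu p) \<longleftrightarrow> False"

lemma computes_ev:
  "arity (length xs) p \<Longrightarrow> computes g p xs (ev g p xs)"
proof (induction p arbitrary: xs)
  case Succ
  then show ?case by (cases xs) (auto intro: computes.succ)
next
  case Oracle
  then show ?case by (cases xs) (auto intro: computes.query)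
next
  case (Comp p qs)
  then show ?case
    by (auto intro!: computes.comp[where ys = "map (\<lambda>q. ev g q xs) qs"] simp: list_all2_conv_all_nth)
next
  case (PrimRec p q)
  then obtain n ys where xs: "xs = n # ys" by (cases xs) auto
  have "computes g (PrimRec p q) (n # ys) (ev g (PrimRec p q) (n # ys))"
    using PrimRec.prems PrimRec.IH unfolding xs
    by (induction n) (auto intro: computes.primrec_0 computes.primrec_Suc)
  then show ?case by (simp only: xs)
qed (auto intro: computes.zero computes.proj)

fun const_program :: "nat \<Rightarrow> program" where
  "const_program 0 = Zero"
| "const_program (Suc n) = Comp Succ [const_program n]"

lemma ev_const [simp]: "ev g (const_program n) xs = n"
  by (induction n) auto

lemma arity_const [simp]: "arity k (const_program n)"
  by (induction n) auto

section \<open>Arithmetic and comparisons as programs\<close>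

definition add_program :: "program \<Rightarrow> program \<Rightarrow> program" where
  "add_program p q = Comp (PrimRec (Proj 0) (Comp Succ [Proj 1])) [p, q]"

lemma ev_add [simp]: "ev g (add_program p q) xs = ev g p xs + ev g q xs"
proof -
  have "rec_nat y (\<lambda>_ z. Suc z) x = x + y" for x y :: nat by (induction x) auto
  then show ?thesis by (simp add: add_program_def)
qed

lemma arity_add [simp]: "arity k (add_program p q) \<longleftrightarrow> arity k p \<and> arity k q"
  by (auto simp: add_program_def)

definition mult_program :: "program \<Rightarrow> program \<Rightarrow> program" where
  "mult_program p q = Comp (PrimRec Zero (add_program (Proj 2) (Proj 1))) [p, q]"

lemma ev_mult [simp]: "ev g (mult_program p q) xs = ev g p xs * ev g q xs"
proof -
  have "rec_nat 0 (\<lambda>_ z. y + z) x = x * y" for x y :: nat by (induction x) auto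
  then show ?thesis by (simp add: mult_program_def numeral_2_eq_2)
qed

lemma arity_mult [simp]: "arity k (mult_program p q) \<longleftrightarrow> arity k p \<and> arity k q"
  by (auto simp: mult_program_def)

definition power_program :: "program \<Rightarrow> program \<Rightarrow> program" where
  "power_program p q = Comp (PrimRec (const_program 1) (mult_program (Proj 2) (Proj 1))) [q, p]"

lemma ev_power [simp]: "ev g (power_program p q) xs = ev g p xs ^ ev g q xs"
proof -
  have "rec_nat (Suc 0) (\<lambda>_ z. y * z) x = y ^ x" for x y :: nat by (induction x) auto
  then show ?thesis by (simp add: power_program_def numeral_2_eq_2)
qed

lemma arity_power [simp]: "arity k (power_program p q) \<longleftrightarrow> arity k p \<and> arity k q"
  by (auto simp: power_program_def)

text \<open>\<open>PrimRec Zero (Proj 0)\<close> is the predecessor, with 0 sent to 0. It is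
  iterated \<open>q\<close> times, so \<open>q\<close> comes first, recursion being on the first
  argument.\<close>

definition diff_program :: "program \<Rightarrow> program \<Rightarrow> program" where
  "diff_program p q = Comp (PrimRec (Proj 0) (Comp (PrimRec Zero (Proj 0)) [Proj 1])) [q, p]"

lemma ev_diff [simp]: "ev g (diff_program p q) xs = ev g p xs - ev g q xs"
proof -
  have pred: "rec_nat 0 (\<lambda>n _. n) z = z - 1" for z :: nat by (cases z) auto
  have "rec_nat y (\<lambda>_ z. z - Suc 0) x = y - x" for x y :: nat by (induction x) auto
  then show ?thesis by (simp add: diff_program_def pred)
qed

lemma arity_diff [simp]: "arity k (diff_program p q) \<longleftrightarrow> arity k p \<and> arity k q"
  by (auto simp: diff_program_def)

definition le_program :: "program \<Rightarrow> program \<Rightarrow> program" where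
  "le_program p q = diff_program (const_program 1) (diff_program p q)"

lemma ev_le [simp]: "ev g (le_program p q) xs = of_bool (ev g p xs \<le> ev g q xs)"
  by (simp add: le_program_def)

lemma arity_le [simp]: "arity k (le_program p q) \<longleftrightarrow> arity k p \<and> arity k q"
  by (auto simp: le_program_def)

definition less_program :: "program \<Rightarrow> program \<Rightarrow> program" where
  "less_program p q = diff_program (const_program 1) (le_program q p)"

lemma ev_less [simp]: "ev g (less_program p q) xs = of_bool (ev g p xs < ev g q xs)"
  by (auto simp: less_program_def)

lemma arity_less [simp]: "arity k (less_program p q) \<longleftrightarrow> arity k p \<and> arity k q"
  by (auto simp: less_program_def)

definition eq_program :: "program \<Rightarrow> program \<Rightarrow> program" where
  "eq_program p q = mult_program (le_program p q) (le_program q p)"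

lemma ev_eq [simp]: "ev g (eq_program p q) xs = of_bool (ev g p xs = ev g q xs)"
  by (auto simp: eq_program_def)

lemma arity_eq [simp]: "arity k (eq_program p q) \<longleftrightarrow> arity k p \<and> arity k q"
  by (auto simp: eq_program_def)

text \<open>The summand \<open>p\<close> sees the summation index as argument 0, in front of the \<open>k\<close> arguments of
  the context.\<close>

definition sum_program :: "nat \<Rightarrow> program \<Rightarrow> program \<Rightarrow> program" where
  "sum_program k n p = Comp
     (PrimRec Zero (add_program (Proj 1) (Comp p (Proj 0 # map (\<lambda>i. Proj (i + 2)) [0..<k]))))
     (n # map Proj [0..<k])"

lemma ev_sum [simp]:
  assumes "length xs = k"
  shows "ev g (sum_program k n p) xs = (\<Sum>i<ev g n xs. ev g p (i # xs))"
proof -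
  have *: "map (\<lambda>i. xs ! i) [0..<k] = xs" using assms by (metis map_nth)
  have "rec_nat 0 (\<lambda>i y. y + ev g p (i # xs)) m = (\<Sum>i<m. ev g p (i # xs))" for m
    by (induction m) auto
  then show ?thesis by (simp add: sum_program_def comp_def *)
qed

lemma arity_sum [simp]: "arity k (sum_program k n p) \<longleftrightarrow> arity k n \<and> arity (Suc k) p"
  by (auto simp: sum_program_def)

text \<open>Counts the \<open>i\<close> with \<open>(i + 1) * y \<le> x\<close>. At
  \<open>y = 0\<close> this gives \<open>x\<close> and not \<open>x div 0 = 0\<close>, hence the
  assumption of \<open>ev_div\<close>.\<close>

definition div_program :: "program \<Rightarrow> program \<Rightarrow> program" where
  "div_program p q = Comp
     (sum_program 2 (Proj 0) (le_program (mult_program (Comp Succ [Proj 0]) (Proj 2)) (Proj 1))) [p, q]"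

lemma ev_div [simp]:
  assumes "0 < ev g q xs"
  shows "ev g (div_program p q) xs = ev g p xs div ev g q xs"
proof -
  have "(\<Sum>i<x. of_bool (Suc i * y \<le> x)) = x div y" if "0 < y" for x y :: nat
  proof -
    have "Suc i * y \<le> x \<longleftrightarrow> i < x div y" for i
      using that less_eq_div_iff_mult_less_eq[of y "Suc i" x] by (simp add: Suc_le_eq)
    then show ?thesis by (intro sum_of_bool_initial) auto
  qed
  with assms show ?thesis by (simp add: div_program_def numeral_2_eq_2)
qed

lemma arity_div [simp]: "arity k (div_program p q) \<longleftrightarrow> arity k p \<and> arity k q"
  by (auto simp: div_program_def numeral_2_eq_2)

definition mod_program :: "program \<Rightarrow> program \<Rightarrow> program" where
  "mod_program p q = diff_program p (mult_program q (div_program p q))"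

lemma ev_mod [simp]:
  assumes "0 < ev g q xs"
  shows "ev g (mod_program p q) xs = ev g p xs mod ev g q xs"
  using assms by (simp add: mod_program_def minus_mult_div_eq_mod)

lemma arity_mod [simp]: "arity k (mod_program p q) \<longleftrightarrow> arity k p \<and> arity k q"
  by (auto simp: mod_program_def)

definition cutoff_program :: "program \<Rightarrow> program" where
  "cutoff_program p =
     power_program (diff_program (mult_program (const_program 4) p) (const_program 1)) (const_program 3)"

lemma ev_cutoff [simp]: "ev g (cutoff_program p) xs = cutoff (ev g p xs)"
  by (simp add: cutoff_program_def cutoff_def)

lemma arity_cutoff [simp]: "arity k (cutoff_program p) \<longleftrightarrow> arity k p"
  by (simp add: cutoff_program_def)

definition threshold_program :: "program \<Rightarrow> program \<Rightarrow> program" where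
  "threshold_program p q = Comp
     (sum_program 2
       (add_program (add_program (cutoff_program (Proj 0)) (const_program 1))
          (mult_program (const_program 2) (Proj 1)))
       (diff_program (const_program 1)
         (mult_program (less_program (cutoff_program (Proj 1)) (Proj 0))
           (le_program (mult_program (Proj 2) (power_program (Proj 1) (Proj 0)))
             (power_program (diff_program (mult_program (const_program 2) (Proj 1)) (const_program 1))
               (Proj 0))))))
     [p, q]"

lemma ev_threshold [simp]: "ev g (threshold_program p q) xs = threshold (ev g p xs) (ev g q xs)"
  unfolding threshold_program_def threshold_def ev.simps
  by (subst ev_sum, simp, rule sum.cong) auto

lemma arity_threshold [simp]: "arity k (threshold_program p q) \<longleftrightarrow> arity k p \<and> arity k q"
  by (simp add: threshold_program_def numeral_2_eq_2)

text \<open>Each sum pushes its index to the front: the arguments are \<open>[j, V, t]\<close>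
  outside, \<open>[l, j, V, t]\<close> in the outer summand and \<open>[k, l, j, V, t]\<close> in
  the inner one, which is where the names of the \<open>let\<close> apply.\<close>

definition scaled_potential_program :: "program \<Rightarrow> program \<Rightarrow> program \<Rightarrow> program" where
  "scaled_potential_program p q r =
    (let k = Proj 0; l = Proj 1; j = Proj 2; V = Proj 3; t = Proj 4;
       two = const_program 2;
       end = add_program l (threshold_program j (diff_program l k));
       rest = diff_program end t
     in Comp
     (sum_program 3 (Proj 2) (sum_program 4 (Proj 0)
       (mult_program
         (mult_program (le_program t end)
           (eq_program (mod_program (div_program V (power_program two k)) (power_program two (diff_program t l)))
             (div_program V (power_program two l))))
         (mult_program (power_program (mult_program two j) rest)
           (power_program (diff_program (mult_program (const_program 4) j) (const_program 1))
             (diff_program (add_program (add_program (cutoff_program j) (const_program 1))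
               (mult_program two t)) rest))))))
     [p, q, r])"

lemma ev_scaled_potential [simp]:
  "ev g (scaled_potential_program p q r) xs = scaled_potential (ev g p xs) (ev g q xs) (ev g r xs)"
  by (simp add: scaled_potential_program_def scaled_potential_def Let_def)

lemma arity_scaled_potential [simp]:
  "arity k (scaled_potential_program p q r) \<longleftrightarrow> arity k p \<and> arity k q \<and> arity k r"
  by (simp add: scaled_potential_program_def Let_def eval_nat_numeral)

definition prefix_program :: "program \<Rightarrow> program \<Rightarrow> program" where
  "prefix_program p q =
    (let t = Proj 0; W = Proj 1; j = Proj 2; pow = power_program (const_program 2) t; t' = Comp Succ [t]
     in Comp (PrimRec Zero (add_program W
         (mult_program
           (less_program (scaled_potential_program j (add_program W pow) t') (scaled_potential_program j W t'))
           pow)))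
       [q, p])"

lemma ev_prefix [simp]: "ev g (prefix_program p q) xs = prefix_code (ev g p xs) (ev g q xs)"
proof -
  have "rec_nat 0 (\<lambda>t W. W + of_bool (scaled_potential j (W + 2 ^ t) (Suc t)
      < scaled_potential j W (Suc t)) * 2 ^ t) t = prefix_code j t" for j t
    by (induction t) simp_all
  then show ?thesis by (simp add: prefix_program_def Let_def)
qed

lemma arity_prefix [simp]: "arity k (prefix_program p q) \<longleftrightarrow> arity k p \<and> arity k q"
  by (auto simp: prefix_program_def Let_def)

definition digit_program :: "program \<Rightarrow> program \<Rightarrow> program" where
  "digit_program p q = mod_program
     (div_program (prefix_program p (Comp Succ [q])) (power_program (const_program 2) q)) (const_program 2)"

lemma ev_digit [simp]: "ev g (digit_program p q) xs = digit (ev g p xs) (ev g q xs)"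
  by (simp add: digit_program_def digit_def del: prefix_code.simps)

lemma arity_digit [simp]: "arity k (digit_program p q) \<longleftrightarrow> arity k p \<and> arity k q"
  by (auto simp: digit_program_def)

subsection \<open>Searching the oracle\<close>

definition triangle_program :: "program \<Rightarrow> program" where
  "triangle_program p = div_program (mult_program p (Comp Succ [p])) (const_program 2)"

lemma ev_triangle [simp]: "ev g (triangle_program p) xs = triangle (ev g p xs)"
  by (simp add: triangle_program_def triangle_def)

lemma arity_triangle [simp]: "arity k (triangle_program p) \<longleftrightarrow> arity k p"
  by (auto simp: triangle_program_def)

definition diagonal_program :: "program \<Rightarrow> program" where
  "diagonal_program p = Comp
     (sum_program 1 (Proj 0) (le_program (triangle_program (Comp Succ [Proj 0])) (Proj 1))) [p]"

lemma triangle_mono: "m \<le> n \<Longrightarrow> triangle m \<le> triangle n"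
  by (induction rule: dec_induct) auto

lemma le_triangle: "n \<le> triangle n"
  by (induction n) auto

lemma prod_decode_eqD: "prod_decode c = (a, b) \<Longrightarrow> c = triangle (a + b) + a"
  using prod_decode_inverse[of c] by (simp add: prod_encode_def)

text \<open>The code is at least \<open>triangle (a + b)\<close> and below
  \<open>triangle (Suc (a + b))\<close>, so exactly the \<open>s < a + b\<close> are
  counted.\<close>

lemma ev_diagonal:
  assumes "prod_decode (ev g p xs) = (a, b)"
  shows "ev g (diagonal_program p) xs = a + b"
proof -
  have code: "ev g p xs = triangle (a + b) + a"
    using assms by (rule prod_decode_eqD)
  have "triangle (Suc s) \<le> triangle (a + b) + a \<longleftrightarrow> s < a + b" for s
  proof
    show "s < a + b" if "triangle (Suc s) \<le> triangle (a + b) + a"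
    proof (rule ccontr)
      assume "\<not> s < a + b"
      then have "triangle (Suc (a + b)) \<le> triangle (Suc s)" by (intro triangle_mono) simp
      with that show False by simp
    qed
    show "triangle (Suc s) \<le> triangle (a + b) + a" if "s < a + b"
      using triangle_mono[of "Suc s" "a + b"] that by simp
  qed
  then have "(\<Sum>s<triangle (a + b) + a. of_bool (triangle (Suc s) \<le> triangle (a + b) + a)) = a + b"
    using le_triangle[of "a + b"] by (intro sum_of_bool_initial) auto
  then show ?thesis by (simp add: diagonal_program_def code del: triangle_Suc)
qed

lemma arity_diagonal [simp]: "arity k (diagonal_program p) \<longleftrightarrow> arity k p"
  by (simp add: diagonal_program_def)

definition fst_program :: "program \<Rightarrow> program" where
  "fst_program p = diff_program p (triangle_program (diagonal_program p))"

definition snd_program :: "program \<Rightarrow> program" where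
  "snd_program p = diff_program (diagonal_program p) (fst_program p)"

lemma ev_fst [simp]: "ev g (fst_program p) xs = fst (prod_decode (ev g p xs))"
proof -
  obtain a b where d: "prod_decode (ev g p xs) = (a, b)" by fastforce
  then show ?thesis
    using prod_decode_eqD[OF d] by (simp add: fst_program_def ev_diagonal[OF d])
qed

lemma ev_snd [simp]: "ev g (snd_program p) xs = snd (prod_decode (ev g p xs))"
  by (cases "prod_decode (ev g p xs)") (simp add: snd_program_def ev_diagonal)

lemma arity_fst [simp]: "arity k (fst_program p) \<longleftrightarrow> arity k p"
  by (auto simp: fst_program_def)

lemma arity_snd [simp]: "arity k (snd_program p) \<longleftrightarrow> arity k p"
  by (auto simp: snd_program_def)

text \<open>Returns 0 on \<open>n\<close> iff the \<open>n\<close>-th approximation certifies \<open>\<epsilon> \<ge> 2\<^sup>-\<^sup>n\<close> with room to spare; the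
  slack bounds the least such \<open>n\<close> in terms of \<open>\<epsilon>\<close> alone, whatever its name.\<close>

definition search_program :: program where
  "search_program =
    (let c = Comp Oracle [Proj 0]; a = fst_program c; b = snd_program c
     in add_program (mod_program a (const_program 2))
       (diff_program (mult_program (const_program 4) (Comp Succ [b]))
         (mult_program a (power_program (const_program 2) (Proj 0)))))"

lemma arity_search: "arity (Suc 0) search_program"
  by (simp add: search_program_def Let_def)

text \<open>Even codes \<open>a = 2 * h\<close> denote \<open>h\<close>, odd ones negative integers;
  clearing denominators in \<open>2 / 2 ^ n \<le> h / (b + 1)\<close> gives the tested
  inequality.\<close>

lemma ev_search_eq_0_iff:
  "ev g search_program [n] = 0 \<longleftrightarrow> 2 / 2 ^ n \<le> (of_rat (rat_decode (g n)) :: real)"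
proof -
  obtain a b where d: "prod_decode (g n) = (a, b)" by fastforce
  have val: "(of_rat (rat_decode (g n)) :: real) = real_of_int (int_decode a) / (real b + 1)"
    by (simp add: rat_decode_def d of_rat_divide of_rat_add add.commute)
  have ev: "ev g search_program [n] = 0 \<longleftrightarrow> even a \<and> 4 * Suc b \<le> a * 2 ^ n"
    by (auto simp: search_program_def Let_def d even_iff_mod_2_eq_zero)
  show ?thesis
  proof (cases "even a")
    case True
    then obtain h where h: "a = 2 * h" by (elim evenE)
    have "int_decode a = int h" by (simp add: h int_decode_def sum_decode_def)
    then have "2 / 2 ^ n \<le> (of_rat (rat_decode (g n)) :: real) \<longleftrightarrow> 2 * (real b + 1) \<le> real h * 2 ^ n"
      unfolding val by (simp add: field_simps)
    also have "\<dots> \<longleftrightarrow> real (2 * Suc b) \<le> real (h * 2 ^ n)" by (simp add: algebra_simps)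
    also have "\<dots> \<longleftrightarrow> 4 * Suc b \<le> a * 2 ^ n" unfolding of_nat_le_iff h by auto
    finally show ?thesis using ev True by simp
  next
    case False
    then have "int_decode a < 0" by (simp add: int_decode_def sum_decode_def)
    then have "(of_rat (rat_decode (g n)) :: real) < 0" unfolding val by (simp add: divide_neg_pos)
    moreover have "(0 :: real) < 2 / 2 ^ n" by simp
    ultimately show ?thesis using ev False by linarith
  qed
qed

text \<open>The search ignores the input \<open>i\<close>, so all digits use one
  \<open>j = 2 * 2 ^ n\<close>; the factor 2 ensures \<open>j \<ge> 2\<close> even if
  \<open>n = 0\<close>.\<close>

definition main_program :: program where
  "main_program = Comp
     (digit_program (mult_program (const_program 2) (power_program (const_program 2) (Proj 0))) (Proj 1))
     [Comp (Mu search_program) [], Proj 0]"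

text \<open>An error of at most \<open>1 / 2 ^ n\<close> turns a certificate
  \<open>2 / 2 ^ n\<close> into \<open>1 / 2 ^ n \<le> \<epsilon>\<close>, and turns
  \<open>3 / 2 ^ n\<^sub>0 \<le> \<epsilon>\<close> into a certificate at \<open>n\<^sub>0\<close>,
  where the search stops at the latest.\<close>

lemma computes_main:
  assumes "real_name g \<epsilon>" "3 / 2 ^ n\<^sub>0 \<le> \<epsilon>"
  shows "\<exists>n\<le>n\<^sub>0. 1 / 2 ^ n \<le> \<epsilon> \<and> (\<forall>i. computes g main_program [i] (digit (2 * 2 ^ n) i))"
proof -
  let ?Z = "\<lambda>n. ev g search_program [n] = 0"
  define n where "n = (LEAST n. ?Z n)"
  have name: "\<bar>of_rat (rat_decode (g n)) - \<epsilon>\<bar> \<le> 1 / 2 ^ n" for n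
    using assms(1) by (simp add: real_name_def)
  have "?Z n\<^sub>0"
    using name[of n\<^sub>0] assms(2) unfolding ev_search_eq_0_iff by (simp add: field_simps abs_le_iff)
  then have n: "?Z n" "n \<le> n\<^sub>0"
    unfolding n_def by (rule LeastI, rule Least_le)
  have least: "\<not> ?Z i" if "i < n" for i
    using that unfolding n_def by (rule not_less_Least)
  have search: "computes g search_program [i] (ev g search_program [i])" for i
    by (rule computes_ev) (simp add: arity_search)
  have "computes g (Mu search_program) [] n"
    using search n(1) least by (intro computes.mu) (metis, blast)
  then have mu: "computes g (Comp (Mu search_program) []) [i] n" for i
    by (intro computes.comp[where ys = "[]"]) auto
  have "computes g main_program [i] (digit (2 * 2 ^ n) i)" for i
  proof -
    let ?p = "digit_program (mult_program (const_program 2) (power_program (const_program 2) (Proj 0))) (Proj 1)"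
    have "computes g ?p [n, i] (ev g ?p [n, i])" by (rule computes_ev) simp
    then have "computes g ?p [n, i] (digit (2 * 2 ^ n) i)" by simp
    moreover have "computes g (Proj 0) [i] i" using computes.proj[of 0 "[i]" g] by simp
    ultimately show ?thesis
      unfolding main_program_def using mu by (intro computes.comp[where ys = "[n, i]"]) auto
  qed
  moreover have "1 / 2 ^ n \<le> \<epsilon>"
    using name[of n] n(1) unfolding ev_search_eq_0_iff by (simp add: abs_le_iff field_simps)
  ultimately show ?thesis using n(2) by blast
qed

theorem theorem5p2:
  "\<exists>\<Phi> :: (nat \<Rightarrow> nat) \<Rightarrow> nat \<Rightarrow> nat option.
     computable_functional \<Phi> \<and>
     (\<forall>\<epsilon> :: real. 0 < \<epsilon> \<and> \<epsilon> < 2 \<longrightarrow>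
       (\<exists>N :: nat. \<forall>g. real_name g \<epsilon> \<longrightarrow>
         (\<forall>i \<ge> 1. \<Phi> g i \<in> {Some 0, Some 1}) \<and>
         (\<forall>k l n :: nat. 1 \<le> k \<and> k < l \<and> N < n \<and> (\<forall>s < n. \<Phi> g (k + s) = \<Phi> g (l + s)) \<longrightarrow>
           real (l - k) > (2 - \<epsilon>) ^ n)))"
proof -
  obtain \<Phi> where \<Phi>: "\<And>g i y. \<Phi> g i = Some y \<longleftrightarrow> computes g main_program [i] y"
    using computable_functional_ex[of main_program] by blast
  have main: "\<exists>N. \<forall>g. real_name g \<epsilon> \<longrightarrow> (\<forall>i\<ge>1. \<Phi> g i \<in> {Some 0, Some 1}) \<and>
      (\<forall>k l n :: nat. 1 \<le> k \<and> k < l \<and> N < n \<and> (\<forall>s < n. \<Phi> g (k + s) = \<Phi> g (l + s)) \<longrightarrow>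
        real (l - k) > (2 - \<epsilon>) ^ n)" if \<epsilon>: "0 < \<epsilon>" "\<epsilon> < 2" for \<epsilon> :: real
  proof -
    obtain n\<^sub>0 where "3 / \<epsilon> < 2 ^ n\<^sub>0" using real_arch_pow[of 2 "3 / \<epsilon>"] by auto
    then have n\<^sub>0: "3 / 2 ^ n\<^sub>0 \<le> \<epsilon>" using \<epsilon> by (simp add: field_simps)
    show ?thesis
    \<comment> \<open>The \<open>m\<close> that is found may vary with the name, but
      \<open>m \<le> n\<^sub>0\<close> and \<open>cutoff\<close> is monotone, so this bound serves
      all names.\<close>
    proof (intro exI[of _ "cutoff (2 * 2 ^ n\<^sub>0)"] allI impI)
      fix g assume "real_name g \<epsilon>"
      then obtain m where m: "m \<le> n\<^sub>0" "1 / 2 ^ m \<le> \<epsilon>"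
        and comp: "\<And>i. computes g main_program [i] (digit (2 * 2 ^ m) i)"
        using computes_main n\<^sub>0 by blast
      define j :: nat where "j = 2 * 2 ^ m"
      have j: "2 \<le> j" "1 / real j \<le> \<epsilon>"
        using m(2) by (auto simp: j_def field_simps)
      have \<Phi>_eq: "\<Phi> g i = Some (digit j i)" for i
        using comp \<Phi> by (simp add: j_def)
      have cutoff: "cutoff j \<le> cutoff (2 * 2 ^ n\<^sub>0)"
        unfolding cutoff_def j_def using m(1) by (intro power_mono diff_le_mono mult_le_mono) auto
      have "(2 - \<epsilon>) ^ n < real (l - k)"
        if kl: "k < l" and n: "cutoff (2 * 2 ^ n\<^sub>0) < n"
          and eq: "\<forall>s < n. \<Phi> g (k + s) = \<Phi> g (l + s)" for k l n
      proof (rule ccontr)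
        assume "\<not> (2 - \<epsilon>) ^ n < real (l - k)"
        then have "real (l - k) \<le> (2 - \<epsilon>) ^ n" by simp
        also have "\<dots> \<le> ((2 * real j - 1) / real j) ^ n"
          using j \<epsilon> by (intro power_mono) (auto simp: diff_divide_distrib)
        finally have "real (l - k) * real j ^ n \<le> (2 * real j - 1) ^ n"
          using j by (simp add: power_divide pos_le_divide_eq)
        then have "real ((l - k) * j ^ n) \<le> real ((2 * j - 1) ^ n)"
          using j by (simp only: of_nat_mult of_nat_power of_nat_diff) simp
        \<comment> \<open>The length \<open>n\<close> is admissible for the distance
          \<open>l - k\<close>, so the match contains one of length
          \<open>threshold j (l - k)\<close>, which is excluded.\<close>
        then have "threshold j (l - k) \<le> n"
          unfolding of_nat_le_iff using n cutoff by (intro threshold_props(4)[OF j(1)]) auto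
        then show False
          using digit_avoids_matches[OF j(1) kl] eq by (auto simp: \<Phi>_eq)
      qed
      moreover have "\<Phi> g i \<in> {Some 0, Some 1}" for i
        by (auto simp: \<Phi>_eq digit_def)
      ultimately show "(\<forall>i\<ge>1. \<Phi> g i \<in> {Some 0, Some 1}) \<and>
        (\<forall>k l n :: nat. 1 \<le> k \<and> k < l \<and> cutoff (2 * 2 ^ n\<^sub>0) < n \<and>
          (\<forall>s < n. \<Phi> g (k + s) = \<Phi> g (l + s)) \<longrightarrow> real (l - k) > (2 - \<epsilon>) ^ n)"
        by blast
    qed
  qed
  have "computable_functional \<Phi>"
    unfolding computable_functional_def using \<Phi> by blast
  with main show ?thesis by blast
qed

end
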